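(* Let $\mathbb F$ be a field with additive group $\Gamma$. Let $G$ be a finite connected graph and let $\mathcal B=\{C_1,\dots,C_r\}\subset\mathcal C(G,\mathbb F)$ be a cyclomatic circuit set of $G$. Then the following are equivalent: 1. $\mathcal B$ is an $\mathbb F$-cycle basis. 2. $\mathcal B$ is a $\Gamma$-circuit generator.
   Context: Graphs are simple and undirected, $G=(V,E)$; $\vec E$ contains both arcs $xy,yx$ for every edge. A circuit $C=(x_1,\dots,x_n)$ is a simple closed walk (simple cycle, $n\ge3$); $\mathcal S(G)$ is the set of circuits. For a group $\Gamma$, $\Phi(G,\Gamma)$ is the set of gain functions $\phi:\vec E\to\Gamma$ with $\phi(xy)=\phi(yx)^{-1}$ (for $\Gamma=(\mathbb F,+)$: $\phi(xy)=-\phi(yx)$; write $\Phi(G,\mathbb F)$). $\phi$ is balanced on $C$ if the product $\phi(x_1x_2)\cdots\phi(x_{n-1}x_n)\phi(x_nx_1)$ (sum, in additive notation) is the identity. A set $\mathcal B$ of circuits is a $\Gamma$-circuit generator if every $\phi\in\Phi(G,\Gamma)$ that is balanced on all circuits in $\mathcal B$ is balanced on all circuits of $G$. A cyclomatic circuit set is a set $\mathcal B\subset\mathcal S(G)$ with $|\mathcal B|=|E|-|V|+1$ (the cyclomatic number). The $\mathbb F$-cycle space is $\mathcal C(G,\mathbb F)=\{\phi\in\Phi(G,\mathbb F):\sum_{y:\,xy\in\vec E}\phi(xy)=0\ \text{for all }x\in V\}$. A circuit $(x_1,\dots,x_n)$, with a chosen direction, is identified with the element of $\mathcal C(G,\mathbb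 F)$ that is $1$ on the arcs $x_1x_2,\dots,x_nx_1$, $-1$ on the reversed arcs and $0$ elsewhere (reversing direction changes the sign). $\mathcal B$ is an $\mathbb F$-cycle basis if it is a vector space basis of $\mathcal C(G,\mathbb F)$. *)

theory Defs
  imports "Graph_Theory.Graph_Theory" "HOL-Library.Function_Algebras"
begin

text \<open>
  A finite simple undirected graph is a \<open>pair_graph\<close>: a finite, loop-free digraph whose arc set
  \<open>parcs G\<close> is symmetric.  So \<open>parcs G\<close> contains both arcs of every edge, and the
  undirected edges are recovered as two-element vertex sets.
\<close>

definition edges :: "'a pair_pre_digraph \<Rightarrow> 'a set set" where
  "edges G = {{x, y} | x y. (x, y) \<in> parcs G}"

text \<open>
  A simple closed walk \<open>(x\<^sub>1, \<dots>, x\<^sub>n)\<close> is given by its arc list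
  \<open>[(x\<^sub>1, x\<^sub>2), \<dots>, (x\<^sub>n, x\<^sub>1)]\<close>.  The predicate \<open>pre_digraph.cycle\<close> also accepts
  \<open>[(x, y), (y, x)]\<close>, hence the condition on the length.
\<close>

definition simple_closed_walk :: "'a pair_pre_digraph \<Rightarrow> ('a \<times> 'a) awalk \<Rightarrow> bool" where
  "simple_closed_walk G p \<longleftrightarrow> pre_digraph.cycle (with_proj G) p \<and> 3 \<le> length p"

definition reverse_walk :: "('a \<times> 'a) awalk \<Rightarrow> ('a \<times> 'a) awalk" where
  "reverse_walk p = rev (map prod.swap p)"

text \<open>
  A circuit has neither a start vertex nor a direction: it is the class of all arc lists that
  traverse it.  Choosing a direction of a circuit means choosing a member of this class.
\<close>

definition circuit_of :: "('a \<times> 'a) awalk \<Rightarrow> ('a \<times> 'a) awalk set" where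
  "circuit_of p = {rotate k p | k. True} \<union> {rotate k (reverse_walk p) | k. True}"

definition circuits :: "'a pair_pre_digraph \<Rightarrow> ('a \<times> 'a) awalk set set" where
  "circuits G = circuit_of ` {p. simple_closed_walk G p}"

text \<open>
  The class \<open>group_add\<close> does not require commutativity, so these definitions make sense for an
  arbitrary group, written additively.  A function on the arcs is represented by the total function
  that extends it by \<open>0\<close>.
\<close>

definition gain_functions :: "'a pair_pre_digraph \<Rightarrow> ('a \<times> 'a \<Rightarrow> 'g::group_add) set" where
  "gain_functions G =
     {\<phi>. (\<forall>x y. (x, y) \<in> parcs G \<longrightarrow> \<phi> (x, y) = - \<phi> (y, x)) \<and> (\<forall>e. e \<notin> parcs G \<longrightarrow> \<phi> e = 0)}"

text \<open>
  On a single circuit the condition below does not depend on the walk \<open>p\<close>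
  (see \<open>gain_zero_circuit_of\<close>).
\<close>

definition balanced_on :: "('a \<times> 'a \<Rightarrow> 'g::group_add) \<Rightarrow> ('a \<times> 'a) awalk set \<Rightarrow> bool" where
  "balanced_on \<phi> C \<longleftrightarrow> (\<forall>p\<in>C. sum_list (map \<phi> p) = 0)"

definition circuit_generator ::
    "'g::group_add itself \<Rightarrow> 'a pair_pre_digraph \<Rightarrow> ('a \<times> 'a) awalk set set \<Rightarrow> bool" where
  "circuit_generator _ G \<B> \<longleftrightarrow> \<B> \<subseteq> circuits G \<and>
     (\<forall>\<phi> :: 'a \<times> 'a \<Rightarrow> 'g. \<phi> \<in> gain_functions G \<longrightarrow>
        (\<forall>C\<in>\<B>. balanced_on \<phi> C) \<longrightarrow> (\<forall>C\<in>circuits G. balanced_on \<phi> C))"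

text \<open>The cyclomatic number is computed in \<open>int\<close> because subtraction on \<open>nat\<close> truncates.\<close>

definition cyclomatic_circuit_set ::
    "'a pair_pre_digraph \<Rightarrow> ('a \<times> 'a) awalk set set \<Rightarrow> bool" where
  "cyclomatic_circuit_set G \<B> \<longleftrightarrow> \<B> \<subseteq> circuits G \<and>
     int (card \<B>) = int (card (edges G)) - int (card (pverts G)) + 1"

definition cycle_space :: "'a pair_pre_digraph \<Rightarrow> ('a \<times> 'a \<Rightarrow> 'f::field) set" where
  "cycle_space G =
     {\<phi> \<in> gain_functions G. \<forall>x\<in>pverts G. (\<Sum>y | (x, y) \<in> parcs G. \<phi> (x, y)) = 0}"

definition circuit_vector :: "('a \<times> 'a) awalk \<Rightarrow> 'a \<times> 'a \<Rightarrow> 'f::field" where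
  "circuit_vector p e =
     (if e \<in> set p then 1 else if prod.swap e \<in> set p then - 1 else 0)"

definition fun_scale :: "'f::field \<Rightarrow> ('e \<Rightarrow> 'f) \<Rightarrow> 'e \<Rightarrow> 'f" where
  "fun_scale c \<phi> = (\<lambda>e. c * \<phi> e)"

interpretation fun_vs: vector_space fun_scale
  by unfold_locales (auto simp: fun_scale_def fun_eq_iff algebra_simps)

definition cycle_basis :: "'a pair_pre_digraph \<Rightarrow> ('a \<times> 'a \<Rightarrow> 'f::field) set \<Rightarrow> bool" where
  "cycle_basis G X \<longleftrightarrow>
     X \<subseteq> cycle_space G \<and> fun_vs.independent X \<and> fun_vs.span X = cycle_space G"

lemma reverse_walk_reverse_walk [simp]: "reverse_walk (reverse_walk p) = p"
  by (simp add: reverse_walk_def rev_map o_def)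

lemma set_reverse_walk [simp]: "set (reverse_walk p) = prod.swap ` set p"
  by (simp add: reverse_walk_def)

lemma sum_list_rotate_eq_0:
  fixes xs :: "'g::group_add list"
  shows "sum_list (rotate k xs) = 0 \<longleftrightarrow> sum_list xs = 0"
proof (induction k)
  case (Suc k)
  have "sum_list (rotate1 ys) = 0 \<longleftrightarrow> sum_list ys = 0" for ys :: "'g list"
    by (cases ys) (simp_all, metis eq_neg_iff_add_eq_0 neg_eq_iff_add_eq_0)
  with Suc show ?case by simp
qed simp

lemma sum_list_reverse_walk:
  assumes "\<phi> \<in> gain_functions G" "set p \<subseteq> parcs G"
  shows "sum_list (map \<phi> (reverse_walk p)) = - sum_list (map \<phi> p)"
  using assms(2)
proof (induction p)
  case (Cons e p)
  obtain x y where e: "e = (x, y)" by fastforce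
  have "\<phi> (x, y) = - \<phi> (y, x)"
    using assms(1) Cons.prems e by (auto simp: gain_functions_def)
  then have "\<phi> (y, x) = - \<phi> e" using e by simp
  with Cons e show ?case by (simp add: reverse_walk_def minus_add)
qed (simp add: reverse_walk_def)

lemma gain_zero_circuit_of:
  assumes "\<phi> \<in> gain_functions G" "set p \<subseteq> parcs G"
  shows "balanced_on \<phi> (circuit_of p) \<longleftrightarrow> sum_list (map \<phi> p) = 0"
proof
  assume "balanced_on \<phi> (circuit_of p)"
  moreover have "rotate 0 p \<in> circuit_of p" unfolding circuit_of_def by blast
  ultimately show "sum_list (map \<phi> p) = 0" by (simp add: balanced_on_def)
next
  assume "sum_list (map \<phi> p) = 0"
  then show "balanced_on \<phi> (circuit_of p)"
    using sum_list_reverse_walk[OF assms]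
    by (auto simp: balanced_on_def circuit_of_def rotate_map[symmetric] sum_list_rotate_eq_0)
qed

end

theory Submission
  imports Defs "HOL-Library.Multiset"
begin

text \<open>
  The proof rests on a duality between gain functions and linear functionals.  For an arc \<open>e\<close> the
  vector \<open>circuit_vector [e]\<close> is \<open>1\<close> on \<open>e\<close>, \<open>- 1\<close> on its reversal and \<open>0\<close> elsewhere; the vector of a
  circuit is the sum of the vectors of its arcs.  So a linear functional that takes the value
  \<open>\<phi> e\<close> on each arc vector takes the value \<open>sum_list (map \<phi> p)\<close> on the circuit vector of \<open>p\<close>: to be
  balanced on a circuit is to vanish on its vector.  Every gain function \<open>\<phi>\<close> extends to such
  a functional (\<open>gain_pairing\<close>), and every functional restricts to such a gain function.

  If the vectors of \<open>\<B>\<close> span the cycle space, a functional that vanishes on them vanishes on all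
  circuit vectors, so \<open>\<B>\<close> is a generator (\<open>spanning_circuits_generate\<close>).  Conversely, let \<open>\<B>\<close> be a
  generator.  If some circuit vector were outside the span of \<open>\<B>\<close>, a functional that separates it from
  this span would restrict to a gain function that is balanced on \<open>\<B>\<close> but not on that circuit.
  Since the circuit vectors span the cycle space (\<open>cycle_space_subset_span_circuits\<close>), so does \<open>\<B>\<close>
  (\<open>generating_circuits_span\<close>).

  Linear independence then comes from counting.  The gain functions have dimension \<open>|E|\<close>, and the cycle
  space is cut out of them by \<open>|V| - 1\<close> linear equations, because the equation at one vertex
  follows from the others.  So a spanning set of the cycle space has at least \<open>|E| - |V| + 1\<close>
  elements (\<open>card_spanning_cycle_space\<close>).  A cyclomatic circuit set that spans has no element to spare.

  In characteristic 2 the vectors of an arc and of its reversal coincide, and the pairing of two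
  antisymmetric functions over all arcs vanishes.  Sums over the edges are therefore taken over an
  orientation, that is, over one arc of each edge.
\<close>

section \<open>Linear conditions and functionals\<close>

lemma sum_fun_apply: "sum f A x = (\<Sum>a\<in>A. f a x)"
  for f :: "'b \<Rightarrow> 'a \<Rightarrow> 'c::comm_monoid_add"
  by (induction A rule: infinite_finite_induct) simp_all

lemma vector_space_field: "vector_space ((*) :: 'f::field \<Rightarrow> 'f \<Rightarrow> 'f)"
  by unfold_locales (simp_all add: algebra_simps)

text \<open>
  Each linear condition costs at most one dimension: if \<open>f y \<noteq> 0\<close> for some \<open>y \<in> S\<close>, then every
  \<open>x \<in> S\<close> differs by a multiple of \<open>y\<close> from an element of \<open>S\<close> on which \<open>f\<close> vanishes.
  This is the part of the rank-nullity theorem that bounds the dimension of the cycle space from below;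
  it is stated for spanning sets so that it also covers vector spaces of infinite dimension.
\<close>

lemma (in vector_space) spanning_set_if_linear_conditions:
  fixes f :: "'i \<Rightarrow> 'b \<Rightarrow> 'a"
  assumes "finite I" "subspace S"
    and "\<And>i. i \<in> I \<Longrightarrow> Vector_Spaces.linear scale (*) (f i)"
    and "{x \<in> S. \<forall>i\<in>I. f i x = 0} \<subseteq> span X"
  shows "\<exists>Y. finite Y \<and> card Y \<le> card I \<and> S \<subseteq> span (X \<union> Y)"
  using assms
proof (induction I arbitrary: S rule: finite_induct)
  case empty
  then show ?case by (intro exI[of _ "{}"]) auto
next
  case (insert i I)
  interpret fi: Vector_Spaces.linear scale "(*)" "f i"
    by (rule insert.prems(2)) simp
  define S' where "S' = {x \<in> S. f i x = 0}"
  have S: "subspace S" by fact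
  have "subspace S'"
    unfolding S'_def
    by (intro subspaceI)
      (auto simp: fi.zero fi.add fi.scale
        intro: subspace_0[OF S] subspace_add[OF S] subspace_scale[OF S])
  then have "\<exists>Y. finite Y \<and> card Y \<le> card I \<and> S' \<subseteq> span (X \<union> Y)"
  proof (rule insert.IH)
    show "Vector_Spaces.linear scale (*) (f k)" if "k \<in> I" for k
      by (rule insert.prems(2)) (use that in simp)
    show "{x \<in> S'. \<forall>k\<in>I. f k x = 0} \<subseteq> span X"
      using insert.prems(3) by (auto simp: S'_def)
  qed
  then obtain Y where Y: "finite Y" "card Y \<le> card I" "S' \<subseteq> span (X \<union> Y)"
    by blast
  show ?case
  proof (cases "S \<subseteq> S'")
    case True
    with Y insert.hyps show ?thesis by (intro exI[of _ Y]) auto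
  next
    case False
    then obtain y where y: "y \<in> S" "f i y \<noteq> 0" by (auto simp: S'_def)
    have "x \<in> span (X \<union> insert y Y)" if "x \<in> S" for x
    proof -
      have "x - scale (f i x / f i y) y \<in> S'"
        using that y S
        by (auto simp: S'_def fi.diff fi.scale subspace_diff subspace_scale)
      then have "x - scale (f i x / f i y) y \<in> span (X \<union> insert y Y)"
        using Y(3) span_mono[of "X \<union> Y" "X \<union> insert y Y"] by auto
      moreover have "scale (f i x / f i y) y \<in> span (X \<union> insert y Y)"
        by (intro span_scale span_base) simp
      ultimately show ?thesis
        by (metis diff_add_cancel span_add)
    qed
    moreover have "card (insert y Y) \<le> card (insert i I)"
      using Y insert.hyps by (simp add: card_insert_if)
    ultimately show ?thesis
      using Y(1) by (intro exI[of _ "insert y Y"]) auto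
  qed
qed

text \<open>
  A basis of \<open>span X\<close> stays independent when \<open>c\<close> is added, so the values \<open>0\<close> on the basis
  and \<open>1\<close> at \<open>c\<close> extend linearly.
\<close>

lemma (in vector_space) separating_functional:
  assumes "c \<notin> span X"
  obtains f where "Vector_Spaces.linear scale (*) f" "\<And>x. x \<in> X \<Longrightarrow> f x = 0" "f c = 1"
proof -
  interpret fld: vector_space "(*) :: 'a \<Rightarrow> 'a \<Rightarrow> 'a" by (rule vector_space_field)
  interpret vector_space_pair scale "(*) :: 'a \<Rightarrow> 'a \<Rightarrow> 'a" ..
  obtain B where B: "B \<subseteq> X" "independent B" "X \<subseteq> span B"
    using maximal_independent_subset by blast
  have c: "c \<notin> span B" using assms B(1) span_mono by blast
  then have "independent (insert c B)" using B(2) by (rule independent_insertI)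
  then obtain f where f: "Vector_Spaces.linear scale (*) f"
      "\<forall>x\<in>insert c B. f x = (if x = c then 1 else 0)"
    using linear_independent_extend[of "insert c B" "\<lambda>x. if x = c then 1 else 0"] by blast
  interpret f: Vector_Spaces.linear scale "(*)" f by fact
  have "f x = 0" if "x \<in> span B" for x
  proof -
    have "subspace {x. f x = 0}"
      by (intro subspaceI) (auto simp: f.zero f.add f.scale)
    moreover have "B \<subseteq> {x. f x = 0}"
      using f(2) c span_base by auto
    ultimately show ?thesis using that span_minimal by blast
  qed
  with B(3) f show thesis by (intro that[of f]) auto
qed

section \<open>Walks as sums of arc vectors\<close>

text \<open>
  A walk is edge-simple if it traverses no edge twice, in either direction.  This is the property of
  circuits that makes their vectors additive: a repeated arc would be counted twice in the sum, but
  only once in \<open>circuit_vector\<close>, and the vectors of an arc and its reversal would cancel.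
\<close>

definition edge_simple :: "('a \<times> 'a) awalk \<Rightarrow> bool" where
  "edge_simple p \<longleftrightarrow> distinct p \<and> (\<forall>e\<in>set p. prod.swap e \<notin> set p)"

lemma circuit_vector_Cons:
  assumes "edge_simple (e # p)"
  shows "circuit_vector (e # p) = circuit_vector [e] + circuit_vector p"
  using assms by (auto simp: edge_simple_def circuit_vector_def fun_eq_iff prod.swap_def)

lemma circuit_vector_sum:
  assumes "edge_simple p"
  shows "circuit_vector p = sum_list (map (\<lambda>e. circuit_vector [e]) p)"
  using assms
proof (induction p)
  case Nil
  then show ?case by (simp add: circuit_vector_def fun_eq_iff)
next
  case (Cons e p)
  then have "edge_simple p" by (auto simp: edge_simple_def)
  with Cons show ?case by (simp only: circuit_vector_Cons list.map sum_list.Cons)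
qed

text \<open>
  The link between the two notions of the theorem: the gain of a circuit is the value of a linear
  functional at its vector.
\<close>

lemma linear_circuit_vector:
  fixes f :: "('a \<times> 'a \<Rightarrow> 'f::field) \<Rightarrow> 'f"
  assumes "Vector_Spaces.linear fun_scale (*) f" "edge_simple p"
    and "\<And>e. e \<in> set p \<Longrightarrow> f (circuit_vector [e]) = \<phi> e"
  shows "f (circuit_vector p) = sum_list (map \<phi> p)"
proof -
  interpret f: Vector_Spaces.linear fun_scale "(*)" f by fact
  have "f (sum_list (map (\<lambda>e. circuit_vector [e]) p)) = sum_list (map \<phi> p)"
    using assms(3) by (induction p) (simp_all add: f.zero f.add)
  then show ?thesis using assms(2) by (simp add: circuit_vector_sum)
qed

lemma circuit_vector_reverse_walk:
  assumes "edge_simple p"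
  shows "circuit_vector (reverse_walk p) = - circuit_vector p"
proof -
  have "e \<in> prod.swap ` set p \<longleftrightarrow> prod.swap e \<in> set p" for e
    by (metis image_iff swap_swap)
  then show ?thesis
    using assms by (auto simp: edge_simple_def circuit_vector_def fun_eq_iff)
qed

text \<open>
  The choice of a direction affects the vector of a circuit only by a sign.
\<close>

lemma circuit_vector_circuit_of:
  assumes "edge_simple q" "p \<in> circuit_of q"
  shows "circuit_vector p = (circuit_vector q :: 'a \<times> 'a \<Rightarrow> 'f::field)
    \<or> circuit_vector p = (- circuit_vector q :: 'a \<times> 'a \<Rightarrow> 'f)"
proof -
  have "(circuit_vector (rotate k r) :: 'a \<times> 'a \<Rightarrow> 'f) = circuit_vector r"
    for k and r :: "('a \<times> 'a) awalk"
    by (simp add: circuit_vector_def fun_eq_iff)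
  with assms show ?thesis
    by (auto simp: circuit_of_def circuit_vector_reverse_walk)
qed

lemma edge_simple_circuit_of:
  assumes "edge_simple q" "p \<in> circuit_of q"
  shows "edge_simple p"
proof -
  have "edge_simple (rotate k r) \<longleftrightarrow> edge_simple r" for k r
    by (simp add: edge_simple_def)
  moreover have "edge_simple (reverse_walk q)"
    using assms(1) by (auto simp: edge_simple_def reverse_walk_def distinct_map)
  ultimately show ?thesis using assms by (auto simp: circuit_of_def)
qed

section \<open>Simple closed walks\<close>

lemma pcas_fst_snd: "pcas u p v \<Longrightarrow> map fst p @ [v] = u # map snd p"
  by (induction u p v rule: pcas.induct) auto

lemma pcas_pawalk_verts: "pcas u p v \<Longrightarrow> pawalk_verts u p = u # map snd p"
  by (induction u p v rule: pcas.induct) auto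

lemma simple_closed_walk_iff:
  "simple_closed_walk G p \<longleftrightarrow>
     3 \<le> length p \<and> set p \<subseteq> parcs G \<and> distinct (map snd p) \<and> (\<exists>u\<in>pverts G. pcas u p u)"
  by (auto simp: simple_closed_walk_def pre_digraph.cycle_def pre_digraph.awalk_def
      cas_with_proj_eq awalk_verts_with_proj_eq pcas_pawalk_verts)

text \<open>
  The heads of the arcs are distinct, and so are the tails, which are the same vertices shifted by one
  place.  If \<open>p\<close> contained an arc and its reversal, the tail of each of them would be the head of
  the other, so each would be the successor of the other on \<open>p\<close>, and \<open>p\<close> would have length 2.
\<close>

lemma simple_closed_walk_edge_simple:
  assumes "simple_closed_walk G p"
  shows "edge_simple p"
proof -
  let ?n = "length p"
  obtain u where n: "3 \<le> ?n" and d: "distinct (map snd p)" and u: "pcas u p u"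
    using assms by (auto simp: simple_closed_walk_iff)
  have shift: "map fst p @ [u] = u # map snd p" using u by (rule pcas_fst_snd)
  then have "mset (map fst p @ [u]) = mset (u # map snd p)" by (rule arg_cong)
  then have "mset (map fst p) = mset (map snd p)" by simp
  then have d': "distinct (map fst p)" using d mset_eq_imp_distinct_iff by blast
  \<comment> \<open>Successor of a position in cyclic order.\<close>
  define nxt where "nxt i = (if Suc i = ?n then 0 else Suc i)" for i
  have nxt: "fst (p ! nxt i) = snd (p ! i)" "nxt i < ?n" if "i < ?n" for i
  proof -
    have "(map fst p @ [u]) ! Suc i = snd (p ! i)" using that shift by simp
    moreover have "fst (p ! 0) = u" using shift n by (cases p) auto
    ultimately show "fst (p ! nxt i) = snd (p ! i)"
      using that by (auto simp: nxt_def nth_append split: if_splits)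
    show "nxt i < ?n" using that n by (auto simp: nxt_def)
  qed
  have fst_inj: "i = j" if "fst (p ! i) = fst (p ! j)" "i < ?n" "j < ?n" for i j
    using nth_eq_iff_index_eq[OF d', of i j] that by simp
  have False if e: "e \<in> set p" "prod.swap e \<in> set p" for e
  proof -
    obtain i j where ij: "i < ?n" "p ! i = e" "j < ?n" "p ! j = prod.swap e"
      using e unfolding in_set_conv_nth by blast
    have i_to_j: "nxt i = j"
      by (rule fst_inj) (use ij nxt[of i] in simp_all)
    have j_to_i: "nxt j = i"
      by (rule fst_inj) (use ij nxt[of j] in simp_all)
    have "Suc i = ?n \<and> j = 0 \<or> Suc i = j"
      using i_to_j by (auto simp: nxt_def split: if_splits)
    moreover have "Suc j = ?n \<and> i = 0 \<or> Suc j = i"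
      using j_to_i by (auto simp: nxt_def split: if_splits)
    ultimately show False using n by (elim disjE conjE) linarith+
  qed
  moreover have "distinct p" using d by (simp add: distinct_map)
  ultimately show ?thesis by (auto simp: edge_simple_def)
qed

lemma set_circuit_of:
  assumes "sym (parcs G)" "set q \<subseteq> parcs G" "p \<in> circuit_of q"
  shows "set p \<subseteq> parcs G"
  using assms by (auto simp: circuit_of_def sym_def)

text \<open>
  Start anywhere in \<open>S\<close> and walk on without ever turning back.  As the graph is finite, a vertex must
  recur; the part of the walk up to the first recurrence closes a circuit.  It has length at
  least 3 because the graph has no loops and the walk never turns back.
\<close>

lemma simple_closed_walk_if_no_dead_end:
  assumes "finite (pverts G)" "S \<subseteq> parcs G" "S \<noteq> {}"
    and "\<And>u v. (u, v) \<in> parcs G \<Longrightarrow> u \<in> pverts G \<and> u \<noteq> v"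
    and ext: "\<And>u v. (u, v) \<in> S \<Longrightarrow> \<exists>w. w \<noteq> u \<and> (v, w) \<in> S"
  obtains p where "simple_closed_walk G p" "set p \<subseteq> S"
proof -
  have "\<exists>a. \<forall>n. a n \<in> S \<and> (fst (a (Suc n)) = snd (a n) \<and> snd (a (Suc n)) \<noteq> fst (a n))"
  proof (rule dependent_nat_choice)
    show "\<exists>e. e \<in> S" using assms(3) by blast
    show "\<exists>e'. e' \<in> S \<and> fst e' = snd e \<and> snd e' \<noteq> fst e" if "e \<in> S" for e
      using ext[of "fst e" "snd e"] that by force
  qed
  then obtain a where aS: "\<And>n. a n \<in> S" and a1: "\<And>n. fst (a (Suc n)) = snd (a n)"
      and a2: "\<And>n. snd (a (Suc n)) \<noteq> fst (a n)" by blast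
  define v where "v n = fst (a n)" for n
  have a: "a n = (v n, v (Suc n))" for n by (simp add: v_def a1)
  have vV: "v n \<in> pverts G" and v1: "v n \<noteq> v (Suc n)" for n
    using assms(4)[of "v n" "v (Suc n)"] aS[of n] assms(2) a[of n] by auto
  have v2: "v n \<noteq> v (Suc (Suc n))" for n using a2[of n] a by (metis fst_conv snd_conv)
  have "\<not> inj v"
    using vV assms(1) by (metis finite_imageD finite_subset image_subsetI infinite_UNIV_nat)
  then have ex: "\<exists>j. \<exists>i<j. v i = v j"
    unfolding inj_def by (metis nat_neq_iff)
  \<comment> \<open>The first time that a vertex recurs; up to then all vertices are distinct.\<close>
  define j where "j = (LEAST j. \<exists>i<j. v i = v j)"
  obtain i where i: "i < j" "v i = v j"
    using LeastI_ex[OF ex] unfolding j_def by blast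
  have first: "v k \<noteq> v l" if "k < l" "l < j" for k l
    using not_less_Least[of l "\<lambda>j. \<exists>i<j. v i = v j"] that unfolding j_def by blast
  define p where "p = map a [i..<j]"
  have "i + 3 \<le> j"
  proof (rule ccontr)
    assume "\<not> i + 3 \<le> j"
    then have "j = Suc i \<or> j = Suc (Suc i)" using i by auto
    then show False using i v1 v2 by metis
  qed
  then have "3 \<le> length p" by (simp add: p_def)
  moreover have "set p \<subseteq> S" using aS by (auto simp: p_def)
  moreover have "pcas (v k) (map a [k..<j]) (v j)" if "k \<le> j" for k
    using that by (induction rule: inc_induct) (simp_all add: upt_conv_Cons a)
  then have "pcas (v i) p (v i)" using i unfolding p_def by (metis less_imp_le)
  moreover have "distinct (map snd p)"
  proof -
    have "inj_on (\<lambda>k. v (Suc k)) {i..<j}"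
    proof (rule linorder_inj_onI')
      fix k l assume kl: "k \<in> {i..<j}" "l \<in> {i..<j}" "k < l"
      show "v (Suc k) \<noteq> v (Suc l)"
      proof (cases "Suc l = j")
        case True
        then show ?thesis using first[of i "Suc k"] kl i by auto
      next
        case False
        then show ?thesis using first[of "Suc k" "Suc l"] kl by auto
      qed
    qed
    then show ?thesis by (simp add: p_def distinct_map inj_on_def a)
  qed
  ultimately show thesis
    using assms(2) vV by (intro that[of p]) (auto simp: simple_closed_walk_iff)
qed

section \<open>The cycle space\<close>

definition net_outflow :: "'a pair_pre_digraph \<Rightarrow> 'a \<Rightarrow> ('a \<times> 'a \<Rightarrow> 'f::field) \<Rightarrow> 'f" where
  "net_outflow G x \<phi> = (\<Sum>y | (x, y) \<in> parcs G. \<phi> (x, y))"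

lemma cycle_space_iff:
  "\<phi> \<in> cycle_space G \<longleftrightarrow> \<phi> \<in> gain_functions G \<and> (\<forall>x\<in>pverts G. net_outflow G x \<phi> = 0)"
  by (simp add: cycle_space_def net_outflow_def)

lemma linear_net_outflow: "Vector_Spaces.linear fun_scale (*) (net_outflow G x)"
  unfolding Vector_Spaces.linear_iff
  by (auto simp: vector_space_field fun_vs.vector_space_axioms net_outflow_def fun_scale_def
      sum.distrib sum_distrib_left)

lemma subspace_gain_functions:
  "fun_vs.subspace (gain_functions G :: ('a \<times> 'a \<Rightarrow> 'f::field) set)"
proof (rule fun_vs.subspaceI)
  fix \<phi> \<psi> :: "'a \<times> 'a \<Rightarrow> 'f" and c :: 'f
  assume \<phi>: "\<phi> \<in> gain_functions G"
  then show "fun_scale c \<phi> \<in> gain_functions G"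
    by (fastforce simp: gain_functions_def fun_scale_def)
  assume \<psi>: "\<psi> \<in> gain_functions G"
  show "\<phi> + \<psi> \<in> gain_functions G"
    using \<phi> \<psi> unfolding gain_functions_def by (simp add: plus_fun_def)
qed (simp add: gain_functions_def)

lemma subspace_cycle_space:
  "fun_vs.subspace (cycle_space G :: ('a \<times> 'a \<Rightarrow> 'f::field) set)"
proof -
  interpret f: Vector_Spaces.linear fun_scale "(*)" "net_outflow G x" for x
    by (rule linear_net_outflow)
  note S = subspace_gain_functions[of G]
  show ?thesis
    by (intro fun_vs.subspaceI)
      (auto simp: cycle_space_iff f.zero f.add f.scale
        intro: fun_vs.subspace_0[OF S] fun_vs.subspace_add[OF S] fun_vs.subspace_scale[OF S])
qed

context pair_graph
begin

lemma sym_parcs: "sym (parcs G)"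
  using pair_sym_arcs by (simp add: symmetric_def)

lemma swap_in_parcs [simp]: "prod.swap e \<in> parcs G \<longleftrightarrow> e \<in> parcs G"
  using sym_parcs by (cases e) (auto simp: sym_def)

lemma finite_out_neighbours [simp]: "finite {y. (x, y) \<in> parcs G}"
  using finite_subset[of "{y. (x, y) \<in> parcs G}" "snd ` parcs G"] pair_finite_arcs by force

lemma swap_neq: "e \<in> parcs G \<Longrightarrow> prod.swap e \<noteq> e"
  using pair_no_loops[of e] by (cases e) auto

lemma arc_vector_gain:
  assumes "e \<in> parcs G"
  shows "(circuit_vector [e] :: 'a \<times> 'a \<Rightarrow> 'f::field) \<in> gain_functions G"
  using assms sym_parcs
  by (auto simp: gain_functions_def circuit_vector_def sym_def dest: no_loops')

lemma net_outflow_arc_vector: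
  assumes "e \<in> parcs G"
  shows "net_outflow G x (circuit_vector [e] :: 'a \<times> 'a \<Rightarrow> 'f::field)
    = of_bool (fst e = x) - of_bool (snd e = x)"
proof -
  obtain u v where e: "e = (u, v)" by fastforce
  have uv: "u \<noteq> v" "(u, v) \<in> parcs G" "(v, u) \<in> parcs G"
    using assms e no_loops' sym_parcs by (auto simp: sym_def)
  have "circuit_vector [e] (x, y) =
      (if y = v then of_bool (u = x) else 0) - (if y = u then of_bool (v = x) else 0 :: 'f)" for y
    using uv e by (auto simp: circuit_vector_def)
  then show ?thesis
    using uv e by (auto simp: net_outflow_def sum_subtractf)
qed

text \<open>
  The net outflow of a walk telescopes; in particular it vanishes for a closed walk.
\<close>

lemma net_outflow_walk:
  assumes "pcas u p v" "set p \<subseteq> parcs G"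
  shows "sum_list (map (\<lambda>e. of_bool (fst e = x) - of_bool (snd e = x)) p)
    = (of_bool (u = x) - of_bool (v = x) :: 'f::field)"
  using assms by (induction u p v rule: pcas.induct) auto

lemma circuit_vector_cycle_space:
  assumes "simple_closed_walk G q"
  shows "(circuit_vector q :: 'a \<times> 'a \<Rightarrow> 'f::field) \<in> cycle_space G"
proof -
  have q: "edge_simple q" "set q \<subseteq> parcs G"
    using assms simple_closed_walk_edge_simple simple_closed_walk_iff by blast+
  obtain u where u: "pcas u q u" using assms by (auto simp: simple_closed_walk_iff)
  have "sum_list (map (\<lambda>e. circuit_vector [e]) q) \<in> (gain_functions G :: ('a \<times> 'a \<Rightarrow> 'f) set)"
    using q(2)
    by (induction q)
      (auto intro: arc_vector_gain fun_vs.subspace_0[OF subspace_gain_functions]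
        fun_vs.subspace_add[OF subspace_gain_functions])
  then have "circuit_vector q \<in> (gain_functions G :: ('a \<times> 'a \<Rightarrow> 'f) set)"
    by (simp add: circuit_vector_sum[OF q(1)])
  moreover have "net_outflow G x (circuit_vector q :: 'a \<times> 'a \<Rightarrow> 'f) = 0" for x
  proof -
    have "net_outflow G x (circuit_vector q :: 'a \<times> 'a \<Rightarrow> 'f)
        = sum_list (map (\<lambda>e. of_bool (fst e = x) - of_bool (snd e = x)) q)"
      by (rule linear_circuit_vector[OF linear_net_outflow q(1)], rule net_outflow_arc_vector)
        (use q(2) in blast)
    also have "\<dots> = 0" using net_outflow_walk[OF u q(2)] by simp
    finally show ?thesis .
  qed
  ultimately show ?thesis by (simp add: cycle_space_iff)
qed

lemma circuitD:
  assumes "C \<in> circuits G" "p \<in> C"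
  shows "edge_simple p" "set p \<subseteq> parcs G"
    and "(circuit_vector p :: 'a \<times> 'a \<Rightarrow> 'f::field) \<in> cycle_space G"
proof -
  obtain q where q: "simple_closed_walk G q" "C = circuit_of q"
    using assms by (auto simp: circuits_def)
  note es = simple_closed_walk_edge_simple[OF q(1)]
  show "edge_simple p" using edge_simple_circuit_of es assms q by blast
  show "set p \<subseteq> parcs G"
    by (rule set_circuit_of[OF sym_parcs, of q]) (use q assms in \<open>auto simp: simple_closed_walk_iff\<close>)
  show "(circuit_vector p :: 'a \<times> 'a \<Rightarrow> 'f::field) \<in> cycle_space G"
    using circuit_vector_circuit_of[OF es, of p, where ?'f = 'f] assms(2) q(2)
      circuit_vector_cycle_space[OF q(1), where ?'f = 'f]
    by (auto intro: fun_vs.subspace_neg[OF subspace_cycle_space])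
qed

text \<open>
  Balance can be tested on any representative of a circuit, hence on the chosen direction.
\<close>

lemma balanced_on_circuit_iff:
  assumes "\<phi> \<in> gain_functions G" "C \<in> circuits G" "p \<in> C"
  shows "balanced_on \<phi> C \<longleftrightarrow> sum_list (map \<phi> p) = 0"
proof
  show "balanced_on \<phi> C \<Longrightarrow> sum_list (map \<phi> p) = 0"
    using assms(3) by (simp add: balanced_on_def)
next
  assume p: "sum_list (map \<phi> p) = 0"
  obtain q where q: "simple_closed_walk G q" "C = circuit_of q"
    using assms by (auto simp: circuits_def)
  have "set q \<subseteq> parcs G" using q by (simp add: simple_closed_walk_iff)
  note rev = sum_list_reverse_walk[OF assms(1) this] and gz = gain_zero_circuit_of[OF assms(1) this]
  have "sum_list (map \<phi> q) = 0"
    using p assms(3) rev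
    by (auto simp: q circuit_of_def rotate_map[symmetric] sum_list_rotate_eq_0)
  then show "balanced_on \<phi> C" using gz q by simp
qed

lemma finite_circuits: "finite (circuits G)"
proof -
  have "{p. simple_closed_walk G p} \<subseteq> {p. set p \<subseteq> parcs G \<and> distinct p}"
    by (auto simp: simple_closed_walk_iff distinct_map)
  then have "finite {p. simple_closed_walk G p}"
    by (rule finite_subset) (rule finite_subset_distinct[OF pair_finite_arcs])
  then show ?thesis unfolding circuits_def by (rule finite_imageI)
qed

text \<open>
  At each vertex the net outflow is \<open>0\<close>, so the support of a nonzero element has no dead end and
  contains a circuit.  Subtracting a suitable multiple of its vector removes an arc from the
  support and adds none; induction on the size of the support does the rest.
\<close>

lemma cycle_space_subset_span_circuits:
  "cycle_space G \<subseteq>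
     fun_vs.span {circuit_vector p :: 'a \<times> 'a \<Rightarrow> 'f::field | p. simple_closed_walk G p}"
    (is "_ \<subseteq> fun_vs.span ?Z")
proof
  fix \<psi> :: "'a \<times> 'a \<Rightarrow> 'f"
  assume "\<psi> \<in> cycle_space G"
  then show "\<psi> \<in> fun_vs.span ?Z"
  proof (induction "card {e. \<psi> e \<noteq> 0}" arbitrary: \<psi> rule: less_induct)
    case less
    define S where "S = {e. \<psi> e \<noteq> 0}"
    have gain: "\<psi> \<in> gain_functions G" using less.prems by (simp add: cycle_space_iff)
    have S: "S \<subseteq> parcs G" using gain by (auto simp: S_def gain_functions_def)
    then have fin: "finite S" using pair_finite_arcs finite_subset by blast
    have symS: "(y, x) \<in> S" if "(x, y) \<in> S" for x y
    proof -
      have "\<psi> (x, y) = - \<psi> (y, x)" using gain that S by (auto simp: gain_functions_def)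
      then show ?thesis using that by (auto simp: S_def)
    qed
    show ?case
    proof (cases "S = {}")
      case True
      then have "\<psi> = 0" by (auto simp: S_def fun_eq_iff)
      then show ?thesis by (simp add: fun_vs.span_zero)
    next
      case False
      have "\<exists>w. w \<noteq> u \<and> (v, w) \<in> S" if uv: "(u, v) \<in> S" for u v
      proof (rule ccontr)
        assume "\<not> ?thesis"
        \<comment> \<open>Otherwise \<open>(v, u)\<close> would be the only arc from \<open>v\<close> that contributes to the net outflow.\<close>
        then have z: "\<psi> (v, w) = 0" if "w \<noteq> u" for w using that by (auto simp: S_def)
        have vu: "(v, u) \<in> S" using symS uv by blast
        then have "(v, u) \<in> parcs G" "v \<in> pverts G" using S in_arcsD1 by auto
        then have "net_outflow G v \<psi> = \<psi> (v, u)"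
          using z by (simp add: net_outflow_def sum.remove[of _ u])
        then show False
          using less.prems \<open>v \<in> pverts G\<close> vu by (simp add: cycle_space_iff S_def)
      qed
      moreover have "u \<in> pverts G \<and> u \<noteq> v" if "(u, v) \<in> parcs G" for u v
        using that in_arcsD1 no_loops' by blast
      ultimately obtain p where p: "simple_closed_walk G p" "set p \<subseteq> S"
        using simple_closed_walk_if_no_dead_end[OF pair_finite_verts S False] by metis
      obtain e where e: "e \<in> set p"
        using p by (cases p) (auto simp: simple_closed_walk_iff)
      define \<psi>' where "\<psi>' = \<psi> - fun_scale (\<psi> e) (circuit_vector p)"
      have "{a. \<psi>' a \<noteq> 0} \<subseteq> S - {e}"
        using p(2) symS e
        by (auto simp: \<psi>'_def fun_scale_def circuit_vector_def S_def split: if_splits)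
      moreover have "e \<in> S" using e p by auto
      ultimately have "card {a. \<psi>' a \<noteq> 0} < card S"
        using fin by (intro psubset_card_mono) auto
      moreover have "\<psi>' \<in> cycle_space G"
        unfolding \<psi>'_def using less.prems circuit_vector_cycle_space[OF p(1)]
        by (intro fun_vs.subspace_diff fun_vs.subspace_scale subspace_cycle_space)
      ultimately have "\<psi>' \<in> fun_vs.span ?Z" using less.hyps unfolding S_def by blast
      then have "\<psi>' + fun_scale (\<psi> e) (circuit_vector p) \<in> fun_vs.span ?Z"
      proof (rule fun_vs.span_add)
        show "fun_scale (\<psi> e) (circuit_vector p) \<in> fun_vs.span ?Z"
          using p(1) by (intro fun_vs.span_scale fun_vs.span_base) blast
      qed
      then show ?thesis by (simp add: \<psi>'_def)
    qed
  qed
qed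

section \<open>Orientations\<close>

lemma orientation_exists:
  obtains A where "A \<subseteq> parcs G" "\<And>e. e \<in> parcs G \<Longrightarrow> e \<in> A \<longleftrightarrow> prod.swap e \<notin> A"
    "card A = card (edges G)"
proof -
  define g where "g E = (SOME e. e \<in> parcs G \<and> {fst e, snd e} = E)" for E
  have g: "g E \<in> parcs G \<and> {fst (g E), snd (g E)} = E" if "E \<in> edges G" for E
    unfolding g_def by (rule someI_ex) (use that in \<open>force simp: edges_def\<close>)
  have in_edges: "{fst e, snd e} \<in> edges G" if "e \<in> parcs G" for e
    using that by (cases e) (auto simp: edges_def)
  have "inj_on g (edges G)" using g by (metis inj_onI)
  then have "card (g ` edges G) = card (edges G)" by (rule card_image)
  moreover have "g ` edges G \<subseteq> parcs G" using g by blast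
  moreover have "e \<in> g ` edges G \<longleftrightarrow> prod.swap e \<notin> g ` edges G" if e: "e \<in> parcs G" for e
  proof -
    let ?E = "{fst e, snd e}"
    have 1: "a \<in> g ` edges G \<longleftrightarrow> g {fst a, snd a} = a" if "a \<in> parcs G" for a
    proof
      assume "a \<in> g ` edges G"
      then obtain E where "E \<in> edges G" "a = g E" by blast
      with g[of E] show "g {fst a, snd a} = a" by simp
    next
      assume "g {fst a, snd a} = a"
      then show "a \<in> g ` edges G" using in_edges[OF that] by (metis imageI)
    qed
    have "g {fst (prod.swap e), snd (prod.swap e)} = g ?E"
      by (simp add: insert_commute)
    moreover have "g ?E = e \<or> g ?E = prod.swap e"
      using g[OF in_edges[OF e]] by (cases e; cases "g ?E") (auto simp: doubleton_eq_iff)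
    ultimately show ?thesis using 1[of e] 1[of "prod.swap e"] e swap_neq[OF e] by auto
  qed
  ultimately show thesis by (intro that)
qed

text \<open>
  The functional pairs its argument with \<open>\<phi>\<close>, summing over one arc of each edge.  Antisymmetry of
  \<open>\<phi>\<close> makes its value on the vector of a reversed arc correct as well.
\<close>

lemma gain_pairing:
  fixes \<phi> :: "'a \<times> 'a \<Rightarrow> 'f::field"
  assumes "\<phi> \<in> gain_functions G"
  obtains L where "Vector_Spaces.linear fun_scale (*) L"
    "\<And>p. edge_simple p \<Longrightarrow> set p \<subseteq> parcs G \<Longrightarrow> L (circuit_vector p) = sum_list (map \<phi> p)"
proof -
  obtain A where A: "A \<subseteq> parcs G" "\<And>e. e \<in> parcs G \<Longrightarrow> e \<in> A \<longleftrightarrow> prod.swap e \<notin> A"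
    using orientation_exists by metis
  have fin: "finite A" using A(1) pair_finite_arcs finite_subset by blast
  define L where "L \<psi> = (\<Sum>a\<in>A. \<phi> a * \<psi> a)" for \<psi> :: "'a \<times> 'a \<Rightarrow> 'f"
  have lin: "Vector_Spaces.linear fun_scale (*) L"
    unfolding Vector_Spaces.linear_iff
    by (auto simp: vector_space_field fun_vs.vector_space_axioms L_def fun_scale_def
        algebra_simps sum.distrib sum_distrib_left)
  have arc: "L (circuit_vector [e]) = \<phi> e" if e: "e \<in> parcs G" for e
  proof -
    have sw: "prod.swap a = e \<longleftrightarrow> a = prod.swap e" for a by auto
    have anti: "\<phi> (prod.swap e) = - \<phi> e"
      using assms e by (cases e) (simp add: gain_functions_def)
    have "L (circuit_vector [e]) =
        (\<Sum>a\<in>A. (if a = e then \<phi> a else 0) - (if a = prod.swap e then \<phi> a else 0))"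
      unfolding L_def using swap_neq[OF e]
      by (intro sum.cong) (auto simp: circuit_vector_def sw)
    also have "\<dots> = (if e \<in> A then \<phi> e else 0) - (if prod.swap e \<in> A then \<phi> (prod.swap e) else 0)"
      using fin by (simp add: sum_subtractf)
    also have "\<dots> = \<phi> e" using A(2)[OF e] anti by auto
    finally show ?thesis .
  qed
  show thesis
    using lin by (rule that) (use arc linear_circuit_vector[OF lin] in blast)
qed

text \<open>
  The arc vectors of an orientation are \<open>|E|\<close> independent gain functions.  The net outflows of a gain
  function sum to \<open>0\<close> over all vertices, since the two arcs of each edge cancel.  So the cycle space
  is given by the conditions at all vertices but one, and a spanning set of it can be enlarged by
  \<open>|V| - 1\<close> elements to one that spans the gain functions.
\<close>

lemma card_spanning_cycle_space:
  fixes X :: "('a \<times> 'a \<Rightarrow> 'f::field) set"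
  assumes "pverts G \<noteq> {}" "finite X" "cycle_space G \<subseteq> fun_vs.span X"
  shows "card (edges G) + 1 \<le> card X + card (pverts G)"
proof -
  obtain r where r: "r \<in> pverts G" using assms(1) by blast
  let ?I = "pverts G - {r}"
  have "net_outflow G r \<psi> = 0"
    if gain: "\<psi> \<in> gain_functions G" and z: "\<forall>x\<in>?I. net_outflow G x \<psi> = 0"
    for \<psi> :: "'a \<times> 'a \<Rightarrow> 'f"
  proof -
    obtain A where A: "A \<subseteq> parcs G" "\<And>e. e \<in> parcs G \<Longrightarrow> e \<in> A \<longleftrightarrow> prod.swap e \<notin> A"
      using orientation_exists by metis
    have fin: "finite A" using A(1) pair_finite_arcs finite_subset by blast
    have un: "parcs G = A \<union> prod.swap ` A"
    proof (intro subset_antisym subsetI)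
      fix e assume e: "e \<in> parcs G"
      have "e = prod.swap (prod.swap e)" by simp
      then show "e \<in> A \<union> prod.swap ` A" using A(2)[OF e] by blast
    next
      fix e assume "e \<in> A \<union> prod.swap ` A"
      then show "e \<in> parcs G" using A(1) swap_in_parcs by blast
    qed
    have dj: "A \<inter> prod.swap ` A = {}" using A by auto
    have "(\<Sum>x\<in>pverts G. net_outflow G x \<psi>) = (\<Sum>e\<in>parcs G. \<psi> e)"
    proof -
      have "parcs G = Sigma (pverts G) (\<lambda>x. {y. (x, y) \<in> parcs G})"
        using in_arcsD1 by auto
      then show ?thesis
        unfolding net_outflow_def using pair_finite_verts by (subst sum.Sigma) auto
    qed
    also have "\<dots> = (\<Sum>e\<in>A. \<psi> e) + (\<Sum>e\<in>A. \<psi> (prod.swap e))"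
      using fin dj by (subst un) (simp add: sum.union_disjoint sum.reindex)
    also have "\<dots> = (\<Sum>e\<in>A. \<psi> e + \<psi> (prod.swap e))" by (simp add: sum.distrib)
    also have "\<dots> = 0"
    proof (rule sum.neutral, rule ballI)
      fix e assume "e \<in> A"
      then have "e \<in> parcs G" using A(1) by blast
      then show "\<psi> e + \<psi> (prod.swap e) = 0"
        using gain by (cases e) (simp add: gain_functions_def)
    qed
    finally show ?thesis
      using z r pair_finite_verts by (simp add: sum.remove[of _ r])
  qed
  then have conditions:
    "{\<psi> \<in> gain_functions G. \<forall>x\<in>?I. net_outflow G x \<psi> = 0} \<subseteq> fun_vs.span X"
    using assms(3) by (force simp: cycle_space_iff)
  have "\<exists>Y. finite Y \<and> card Y \<le> card ?I \<and> gain_functions G \<subseteq> fun_vs.span (X \<union> Y)"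
    by (rule fun_vs.spanning_set_if_linear_conditions[where f = "net_outflow G"])
      (use conditions pair_finite_verts in
        \<open>simp_all add: subspace_gain_functions linear_net_outflow\<close>)
  then obtain Y where Y: "finite Y" "card Y \<le> card ?I"
      "gain_functions G \<subseteq> fun_vs.span (X \<union> Y)"
    by blast
  obtain A where A: "A \<subseteq> parcs G" "\<And>e. e \<in> parcs G \<Longrightarrow> e \<in> A \<longleftrightarrow> prod.swap e \<notin> A"
      "card A = card (edges G)"
    using orientation_exists by metis
  have fin: "finite A" using A(1) pair_finite_arcs finite_subset by blast
  let ?b = "\<lambda>e. circuit_vector [e] :: 'a \<times> 'a \<Rightarrow> 'f"
  have b: "?b a e = (if a = e then 1 else 0)" if "a \<in> A" "e \<in> A" for a e
  proof -
    have "prod.swap e \<notin> A" using that(2) A(1,2) by blast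
    then have "prod.swap e \<noteq> a" using that(1) by blast
    then show ?thesis by (simp add: circuit_vector_def)
  qed
  have inj: "inj_on ?b A"
    by (rule inj_onI) (metis b zero_neq_one)
  have "fun_vs.independent (?b ` A)"
  proof (rule fun_vs.independent_if_scalars_zero)
    show "finite (?b ` A)" using fin by simp
  next
    fix u x
    assume u: "(\<Sum>x\<in>?b ` A. fun_scale (u x) x) = 0" and "x \<in> ?b ` A"
    then obtain e where e: "e \<in> A" "x = ?b e" by blast
    have "0 = (\<Sum>a\<in>A. fun_scale (u (?b a)) (?b a)) e"
      using u inj by (simp add: sum.reindex)
    also have "\<dots> = (\<Sum>a\<in>A. if a = e then u (?b a) else 0)"
      unfolding sum_fun_apply using b e by (intro sum.cong) (auto simp: fun_scale_def)
    also have "\<dots> = u x" using e fin by simp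
    finally show "u x = 0" by simp
  qed
  moreover have "?b ` A \<subseteq> fun_vs.span (X \<union> Y)"
    using A(1) Y(3) arc_vector_gain[where ?'f = 'f] by blast
  ultimately have "card (?b ` A) \<le> card (X \<union> Y)"
    using fun_vs.independent_span_bound assms(2) Y(1) by blast
  also have "\<dots> \<le> card X + card Y" by (rule card_Un_le)
  finally have "card (edges G) \<le> card X + card ?I"
    using Y(2) card_image[OF inj] A(3) by linarith
  moreover have "card (pverts G) = card ?I + 1"
    using card_Suc_Diff1[OF pair_finite_verts r] by simp
  ultimately show ?thesis by linarith
qed

section \<open>Cycle bases and circuit generators\<close>

lemma spanning_circuits_generate:
  fixes dir :: "('a \<times> 'a) awalk set \<Rightarrow> ('a \<times> 'a) awalk"
  assumes "\<B> \<subseteq> circuits G" "\<forall>C\<in>\<B>. dir C \<in> C"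
    and span: "cycle_space G \<subseteq>
      fun_vs.span ((\<lambda>C. circuit_vector (dir C) :: 'a \<times> 'a \<Rightarrow> 'f::field) ` \<B>)"
  shows "circuit_generator TYPE('f) G \<B>"
  unfolding circuit_generator_def
proof (intro conjI allI impI ballI assms(1))
  fix \<phi> :: "'a \<times> 'a \<Rightarrow> 'f" and C
  assume \<phi>: "\<phi> \<in> gain_functions G" and bal: "\<forall>C\<in>\<B>. balanced_on \<phi> C" and C: "C \<in> circuits G"
  obtain L where L: "Vector_Spaces.linear fun_scale (*) L"
    "\<And>p. edge_simple p \<Longrightarrow> set p \<subseteq> parcs G \<Longrightarrow> L (circuit_vector p) = sum_list (map \<phi> p)"
    using gain_pairing[OF \<phi>] by blast
  interpret L: Vector_Spaces.linear fun_scale "(*)" L by fact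
  have "fun_vs.subspace {\<psi>. L \<psi> = 0}"
    by (intro fun_vs.subspaceI) (auto simp: L.zero L.add L.scale)
  moreover have "L (circuit_vector (dir D)) = 0" if "D \<in> \<B>" for D
    using that assms bal L(2) circuitD[of D "dir D"] by (auto simp: balanced_on_def)
  ultimately have "cycle_space G \<subseteq> {\<psi>. L \<psi> = 0}"
    using span fun_vs.span_minimal[of "(\<lambda>C. circuit_vector (dir C)) ` \<B>" "{\<psi>. L \<psi> = 0}"] by blast
  then show "balanced_on \<phi> C"
    unfolding balanced_on_def
    using circuitD(1,2)[OF C] circuitD(3)[OF C, where ?'f = 'f] L(2) by (metis (mono_tags) mem_Collect_eq subsetD)
qed

text \<open>
  Suppose that the vector of a circuit \<open>q\<close> is not in the span, and separate it by a functional
  \<open>f\<close>.  The values of \<open>f\<close> on the arc vectors form a gain function, which is balanced on \<open>\<B>\<close>, where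
  \<open>f\<close> vanishes, but has gain \<open>1\<close> on \<open>q\<close>.
\<close>

lemma generating_circuits_span:
  fixes dir :: "('a \<times> 'a) awalk set \<Rightarrow> ('a \<times> 'a) awalk"
  assumes gen: "circuit_generator TYPE('f::field) G \<B>" and dir: "\<forall>C\<in>\<B>. dir C \<in> C"
  shows "cycle_space G \<subseteq> fun_vs.span ((\<lambda>C. circuit_vector (dir C) :: 'a \<times> 'a \<Rightarrow> 'f) ` \<B>)"
    (is "_ \<subseteq> fun_vs.span ?X")
proof -
  have B: "\<B> \<subseteq> circuits G" using gen by (simp add: circuit_generator_def)
  have "circuit_vector q \<in> fun_vs.span ?X" if q: "simple_closed_walk G q" for q
  proof (rule ccontr)
    assume "circuit_vector q \<notin> fun_vs.span ?X"
    from fun_vs.separating_functional[OF this]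
    obtain f where f: "Vector_Spaces.linear fun_scale (*) f" "\<And>x. x \<in> ?X \<Longrightarrow> f x = 0"
        "f (circuit_vector q) = 1"
      by metis
    interpret f: Vector_Spaces.linear fun_scale "(*)" f by fact
    define \<phi> where "\<phi> e = (if e \<in> parcs G then f (circuit_vector [e]) else 0)" for e
    have "\<phi> (x, y) = - \<phi> (y, x)" if "(x, y) \<in> parcs G" for x y
    proof -
      have "edge_simple [(y, x)]"
        using no_loops'[OF that] by (auto simp: edge_simple_def)
      then have "(circuit_vector [(x, y)] :: 'a \<times> 'a \<Rightarrow> 'f) = - circuit_vector [(y, x)]"
        by (subst circuit_vector_reverse_walk[symmetric]) (simp_all add: reverse_walk_def)
      moreover have "(y, x) \<in> parcs G" using that sym_parcs by (auto simp: sym_def)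
      ultimately show ?thesis using that by (simp add: \<phi>_def f.neg)
    qed
    then have \<phi>: "\<phi> \<in> gain_functions G" by (auto simp: gain_functions_def \<phi>_def)
    have sum: "sum_list (map \<phi> p) = f (circuit_vector p)"
      if "edge_simple p" "set p \<subseteq> parcs G" for p
      by (rule linear_circuit_vector[OF f(1) that(1), symmetric])
        (use that(2) in \<open>auto simp: \<phi>_def\<close>)
    have "balanced_on \<phi> C" if "C \<in> \<B>" for C
      using that B dir balanced_on_circuit_iff[OF \<phi>, of C "dir C"] circuitD[of C "dir C"]
        sum[of "dir C"] f(2) by auto
    then have all: "balanced_on \<phi> C" if "C \<in> circuits G" for C
      using that gen \<phi> by (auto simp: circuit_generator_def)
    have "circuit_of q \<in> circuits G" using q by (auto simp: circuits_def)
    moreover have "set q \<subseteq> parcs G" using q by (simp add: simple_closed_walk_iff)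
    ultimately have "sum_list (map \<phi> q) = 0"
      using all gain_zero_circuit_of[OF \<phi>] by blast
    then show False
      using sum[of q] f(3) simple_closed_walk_edge_simple[OF q] \<open>set q \<subseteq> parcs G\<close> by simp
  qed
  then have "{circuit_vector p :: 'a \<times> 'a \<Rightarrow> 'f | p. simple_closed_walk G p} \<subseteq> fun_vs.span ?X"
    by blast
  then have "fun_vs.span {circuit_vector p :: 'a \<times> 'a \<Rightarrow> 'f | p. simple_closed_walk G p}
      \<subseteq> fun_vs.span ?X"
    by (intro fun_vs.span_minimal) auto
  with cycle_space_subset_span_circuits show ?thesis by (rule subset_trans)
qed

end

theorem theorem5p3:
  fixes G :: "'a pair_pre_digraph"
    and \<B> :: "('a \<times> 'a) awalk set set"
    and dir :: "('a \<times> 'a) awalk set \<Rightarrow> ('a \<times> 'a) awalk"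
  assumes "pair_graph G"
    and "connected (with_proj G)"
    and "cyclomatic_circuit_set G \<B>"
    and "\<forall>C\<in>\<B>. dir C \<in> C"
  shows "cycle_basis G ((\<lambda>C. circuit_vector (dir C) :: 'a \<times> 'a \<Rightarrow> 'f::field) ` \<B>)
     \<longleftrightarrow> circuit_generator TYPE('f) G \<B>"
    (is "cycle_basis G ?X \<longleftrightarrow> _")
proof
  interpret pair_graph G by fact
  have B: "\<B> \<subseteq> circuits G"
    and card_B: "int (card \<B>) = int (card (edges G)) - int (card (pverts G)) + 1"
    using assms(3) by (simp_all add: cyclomatic_circuit_set_def)
  show "circuit_generator TYPE('f) G \<B>" if "cycle_basis G ?X"
    using spanning_circuits_generate[OF B assms(4), where ?'f = 'f] that by (simp add: cycle_basis_def)
  show "cycle_basis G ?X" if gen: "circuit_generator TYPE('f) G \<B>"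
  proof -
    have sub: "?X \<subseteq> cycle_space G" using circuitD(3)[where ?'f = 'f] B assms(4) by blast
    have span: "cycle_space G \<subseteq> fun_vs.span ?X"
      using generating_circuits_span[OF gen assms(4)] .
    have V: "pverts G \<noteq> {}"
      using assms(2) by (auto simp: connected_def strongly_connected_def)
    have fin: "finite \<B>" using B finite_circuits finite_subset by blast
    \<comment> \<open>A redundant vector could be dropped, which would leave fewer than
        \<open>|E| - |V| + 1\<close> vectors to span the cycle space.\<close>
    have "fun_vs.independent ?X"
    proof
      assume "fun_vs.dependent ?X"
      then obtain x where x: "x \<in> ?X" "x \<in> fun_vs.span (?X - {x})"
        unfolding fun_vs.dependent_def by blast
      then have "fun_vs.span ?X = fun_vs.span (?X - {x})"
        using fun_vs.span_redundant[of x "?X - {x}"] by (simp add: insert_absorb)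
      then have "card (edges G) + 1 \<le> card (?X - {x}) + card (pverts G)"
        using card_spanning_cycle_space[OF V, of "?X - {x}"] span fin by simp
      moreover have "card (?X - {x}) < card ?X"
        using x(1) fin by (intro psubset_card_mono) auto
      moreover have "card ?X \<le> card \<B>" using fin by (rule card_image_le)
      ultimately show False using card_B by linarith
    qed
    then show ?thesis
      using fun_vs.span_subspace[OF sub span subspace_cycle_space] sub
      by (simp add: cycle_basis_def)
  qed
qed

end
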